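(* For a nontrivial atomic Puiseux monoid $M$, the following statements are equivalent. (1) $M$ is an OHFM. (2) $|\mathcal{A}(M)| \le 2$. (3) $M$ is isomorphic to a numerical monoid with embedding dimension $1$ or $2$.
   Context: A Puiseux monoid is an additive submonoid $M$ of $\mathbb{Q}_{\ge 0}$; it is nontrivial if $M \ne \{0\}$. An element $a \in M\setminus\{0\}$ is an atom if $a = x+y$ with $x,y \in M$ implies $x=0$ or $y=0$; $\mathcal{A}(M)$ is the set of atoms; $M$ is atomic if each nonzero element is a (finite) sum of atoms. A factorization of $x \in M$ is a finite multiset $z$ of atoms of $M$ with sum $x$; its length $|z|$ is the number of atoms counted with multiplicity; $\mathsf{Z}(x)$ is the set of factorizations of $x$. An atomic $M$ is an OHFM (other-half-factorial monoid) if for all $x \in M\setminus\{0\}$ and $z,z' \in \mathsf{Z}(x)$, $|z| = |z'|$ implies $z = z'$. A numerical monoid is a submonoid $N$ of $(\mathbb{N}_0,+)$, $\mathbb{N}_0 = \{0,1,2,\dots\}$, with $\mathbb{N}_0\setminus N$ finite; its embedding dimension is $|\mathcal{A}(N)|$. *)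

theory Defs
  imports Complex_Main "HOL-Library.Multiset"
begin

text \<open>Monoids are carrier sets inside a type of class \<^class>\<open>comm_monoid_add\<close>
  (here \<^typ>\<open>rat\<close> and \<^typ>\<open>nat\<close>), with the addition and zero of that type.\<close>

definition add_submonoid :: "'a::comm_monoid_add set \<Rightarrow> bool" where
  "add_submonoid M \<longleftrightarrow> 0 \<in> M \<and> (\<forall>x\<in>M. \<forall>y\<in>M. x + y \<in> M)"

definition puiseux_monoid :: "rat set \<Rightarrow> bool" where
  "puiseux_monoid M \<longleftrightarrow> add_submonoid M \<and> M \<subseteq> {0..}"

definition numerical_monoid :: "nat set \<Rightarrow> bool" where
  "numerical_monoid N \<longleftrightarrow> add_submonoid N \<and> finite (UNIV - N)"

definition atoms :: "'a::comm_monoid_add set \<Rightarrow> 'a set" where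
  "atoms M = {a \<in> M - {0}. \<forall>x\<in>M. \<forall>y\<in>M. a = x + y \<longrightarrow> x = 0 \<or> y = 0}"

definition factorizations :: "'a::comm_monoid_add set \<Rightarrow> 'a \<Rightarrow> 'a multiset set" where
  "factorizations M x = {z. set_mset z \<subseteq> atoms M \<and> \<Sum>\<^sub># z = x}"

definition atomic :: "'a::comm_monoid_add set \<Rightarrow> bool" where
  "atomic M \<longleftrightarrow> (\<forall>x\<in>M - {0}. factorizations M x \<noteq> {})"

definition OHFM :: "'a::comm_monoid_add set \<Rightarrow> bool" where
  "OHFM M \<longleftrightarrow> atomic M \<and>
     (\<forall>x\<in>M - {0}. \<forall>z\<in>factorizations M x. \<forall>z'\<in>factorizations M x.
        size z = size z' \<longrightarrow> z = z')"

definition monoid_isomorphic ::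
    "'a::comm_monoid_add set \<Rightarrow> 'b::comm_monoid_add set \<Rightarrow> bool" where
  "monoid_isomorphic M N \<longleftrightarrow>
     (\<exists>f. bij_betw f M N \<and> f 0 = 0 \<and> (\<forall>x\<in>M. \<forall>y\<in>M. f (x + y) = f x + f y))"

text \<open>\<^const>\<open>card\<close> of an infinite set is 0, so a nonzero value of
  \<open>embedding_dimension\<close> entails that the set of atoms is finite.\<close>

definition embedding_dimension :: "nat set \<Rightarrow> nat" where
  "embedding_dimension N = card (atoms N)"

end

theory Submission
  imports Defs "HOL-Number_Theory.Cong"
begin

text \<open>Among three atoms \<open>a < b < c\<close> the ratio \<open>(c - b) / (b - a)\<close> is a positive rational \<open>m / n\<close>,
  so \<open>m a + n c = (m + n) b\<close> are two factorizations of equal length. With at most two atoms, length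
  and sum form an invertible linear system in the multiplicities. Moreover, scaling then turns the
  atoms into coprime integers, and these generate a cofinite submonoid of the natural numbers.\<close>

text \<open>Used twice: for the multiplicities in the relation among three atoms, where only
  positivity matters, and for rescaling two atoms, where coprimality is essential.\<close>

lemma pos_rat_coprime_fraction:
  fixes r :: rat
  assumes "0 < r"
  obtains p q :: nat where "0 < p" "0 < q" "coprime p q" "r = of_nat p / of_nat q"
proof -
  obtain k d where kd: "quotient_of r = (k, d)" by fastforce
  then have r: "r = of_int k / of_int d" and d: "0 < d" and "coprime k d"
    using quotient_of_div quotient_of_denom_pos quotient_of_coprime by blast+
  have "0 < k" using assms r d by (simp add: zero_less_divide_iff)
  show thesis
  proof (rule that)
    show "0 < nat k" "0 < nat d" using \<open>0 < k\<close> d by auto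
    show "coprime (nat k) (nat d)"
      using \<open>coprime k d\<close> \<open>0 < k\<close> d by (simp flip: coprime_int_iff)
    show "r = of_nat (nat k) / of_nat (nat d)" using r \<open>0 < k\<close> d by simp
  qed
qed

text \<open>Since \<open>p\<close> is invertible modulo \<open>q\<close>, some multiple
  \<open>i * p\<close> with \<open>i < q\<close> is congruent to any given \<open>n\<close>. Once
  \<open>n\<close> is at least \<open>p * q\<close>, this multiple does not exceed \<open>n\<close>,
  and the rest is a multiple of \<open>q\<close>. So every gap lies below
  \<open>p * q\<close>.\<close>

lemma numerical_monoid_coprime:
  fixes p q :: nat
  assumes "0 < q" "coprime p q"
  shows "numerical_monoid {i * p + j * q |i j. True}" (is "numerical_monoid ?N")
  unfolding numerical_monoid_def
proof
  show "add_submonoid ?N"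
    unfolding add_submonoid_def
  proof (intro conjI ballI)
    show "0 \<in> ?N" by auto
    fix x y assume "x \<in> ?N" "y \<in> ?N"
    then obtain i j i' j' where "x = i * p + j * q" "y = i' * p + j' * q" by blast
    then have "x + y = (i + i') * p + (j + j') * q" by (simp add: algebra_simps)
    then show "x + y \<in> ?N" by blast
  qed
  have "n \<in> ?N" if n: "p * q \<le> n" for n
  proof -
    obtain u where u: "[p * u = 1] (mod q)"
      using cong_solve_coprime_nat[OF assms(2)] by auto
    define i where "i = u * n mod q"
    have "[p * i = p * (u * n)] (mod q)"
      unfolding i_def by (intro cong_mult cong_refl) (simp add: cong_def)
    also have "[p * (u * n) = n] (mod q)"
      using cong_mult[OF u cong_refl[of n]] by (simp add: mult.assoc)
    finally have c: "[n = p * i] (mod q)" by (rule cong_sym)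
    have "i < q" using assms(1) by (simp add: i_def)
    \<comment> \<open>This bound makes the subtraction \<open>n - p * i\<close> on natural numbers a
      true difference.\<close>
    then have le: "p * i \<le> n" using n mult_le_mono2[of i q p] by linarith
    then have "q dvd n - p * i" using c cong_altdef_nat by blast
    then obtain j where "n - p * i = q * j" by (elim dvdE)
    then have "n = i * p + j * q" using le by (simp add: algebra_simps)
    then show ?thesis by blast
  qed
  then have "UNIV - ?N \<subseteq> {..<p * q}" by (fastforce simp: not_less[symmetric])
  then show "finite (UNIV - ?N)" by (rule finite_subset) simp
qed

text \<open>The case \<open>a = b\<close> is allowed, with \<open>i\<close> and \<open>j\<close>
  then not unique, so that monoids with one atom and with two atoms are treated together.\<close>

lemma mset_over_pair:
  assumes "set_mset z \<subseteq> {a, b}"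
  obtains i j where "z = replicate_mset i a + replicate_mset j b"
proof -
  from assms have "\<exists>i j. z = replicate_mset i a + replicate_mset j b"
  proof (induction z)
    case empty
    have "{#} = replicate_mset 0 a + replicate_mset 0 b" by simp
    then show ?case by blast
  next
    case (add x z)
    then obtain i j where z: "z = replicate_mset i a + replicate_mset j b" by auto
    from add.prems consider "x = a" | "x = b" by auto
    then show ?case
    proof cases
      case 1
      with z have "add_mset x z = replicate_mset (Suc i) a + replicate_mset j b" by simp
      then show ?thesis by blast
    next
      case 2
      with z have "add_mset x z = replicate_mset i a + replicate_mset (Suc j) b" by simp
      then show ?thesis by blast
    qed
  qed
  then show thesis using that by blast
qed

lemma sum_mset_in_add_submonoid:
  assumes "add_submonoid M" "set_mset z \<subseteq> M"
  shows "\<Sum>\<^sub># z \<in> M"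
  using assms(2) by (induction z) (use assms(1) in \<open>auto simp: add_submonoid_def\<close>)

text \<open>Atoms are defined through addition and zero alone. As \<open>f\<close> is injective on
  \<open>M\<close>, it both preserves and reflects the equations \<open>x = 0\<close> and
  \<open>a = x + y\<close>.\<close>

lemma atoms_isomorphic_image:
  assumes M: "add_submonoid M" and bij: "bij_betw f M N" and f0: "f 0 = 0"
    and add: "\<And>x y. x \<in> M \<Longrightarrow> y \<in> M \<Longrightarrow> f (x + y) = f x + f y"
  shows "atoms N = f ` atoms M"
proof -
  have inj: "inj_on f M" and N: "N = f ` M" using bij by (auto simp: bij_betw_def)
  have zero: "0 \<in> M" and cl: "\<And>x y. x \<in> M \<Longrightarrow> y \<in> M \<Longrightarrow> x + y \<in> M"
    using M by (auto simp: add_submonoid_def)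
  have eq0: "f x = 0 \<longleftrightarrow> x = 0" if "x \<in> M" for x
    using inj_on_eq_iff[OF inj that zero] f0 by simp
  have eq_add: "f a = f x + f y \<longleftrightarrow> a = x + y" if "a \<in> M" "x \<in> M" "y \<in> M" for a x y
    using inj_on_eq_iff[OF inj that(1) cl[OF that(2,3)]] add that by simp
  have "f a \<in> atoms N \<longleftrightarrow> a \<in> atoms M" if "a \<in> M" for a
    using that by (simp add: atoms_def N eq0 eq_add)
  moreover have "atoms N \<subseteq> f ` M" "atoms M \<subseteq> M" by (auto simp: N atoms_def)
  ultimately show ?thesis by blast
qed

lemma card_atoms_isomorphic:
  assumes "add_submonoid M" "monoid_isomorphic M N"
  shows "card (atoms N) = card (atoms M)"
proof -
  obtain f where f: "bij_betw f M N" "f 0 = 0" "\<forall>x\<in>M. \<forall>y\<in>M. f (x + y) = f x + f y"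
    using assms(2) by (auto simp: monoid_isomorphic_def)
  then have "atoms N = f ` atoms M" using atoms_isomorphic_image[OF assms(1)] by blast
  moreover have "inj_on f (atoms M)"
    using f(1) by (rule inj_on_subset[OF bij_betw_imp_inj_on]) (auto simp: atoms_def)
  ultimately show ?thesis by (simp add: card_image)
qed

lemma three_atoms_imp_not_OHFM:
  fixes M :: "rat set"
  assumes abc: "{a, b, c} \<subseteq> atoms M" "a < b" "b < c" and M: "puiseux_monoid M"
  shows "\<not> OHFM M"
proof
  assume "OHFM M"
  have "0 < (c - b) / (b - a)" using abc by simp
  then obtain m n :: nat where mn: "0 < m" "0 < n" "(c - b) / (b - a) = of_nat m / of_nat n"
    by (rule pos_rat_coprime_fraction)
  let ?z = "replicate_mset (m + n) b" and ?z' = "replicate_mset m a + replicate_mset n c"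
  have "of_nat n * (c - b) = of_nat m * (b - a)" using mn abc by (simp add: field_simps)
  then have eq: "\<Sum>\<^sub># ?z = \<Sum>\<^sub># ?z'" by (simp add: algebra_simps)
  \<comment> \<open>\<open>OHFM\<close> compares factorizations of nonzero elements of
    \<open>M\<close> only, so the common sum must be shown to be one.\<close>
  have "b \<in> M" "b \<noteq> 0" and sub: "set_mset ?z \<subseteq> M"
    using abc(1) by (auto simp: atoms_def split: if_splits)
  then have "0 < b" using M by (auto simp: puiseux_monoid_def order_less_le)
  then have "\<Sum>\<^sub># ?z \<noteq> 0" using mn
    by (metis add_gr_0 mult_pos_pos of_nat_0_less_iff order_less_irrefl sum_mset_replicate_mset)
  moreover have "\<Sum>\<^sub># ?z \<in> M"
    using M sub by (intro sum_mset_in_add_submonoid) (auto simp: puiseux_monoid_def)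
  moreover have "?z \<in> factorizations M (\<Sum>\<^sub># ?z)" "?z' \<in> factorizations M (\<Sum>\<^sub># ?z)"
    using abc(1) eq by (auto simp: factorizations_def split: if_splits)
  moreover have "size ?z = size ?z'" by simp
  ultimately have "?z = ?z'" using \<open>OHFM M\<close> unfolding OHFM_def by blast
  \<comment> \<open>The atom \<open>a\<close> differs from \<open>b\<close> and \<open>c\<close>, so
    it occurs 0 times on the left and \<open>m > 0\<close> times on the right.\<close>
  then have "count ?z a = count ?z' a" by simp
  then show False using mn abc by (simp split: if_splits)
qed

lemma OHFM_imp_at_most_two_atoms:
  fixes M :: "rat set"
  assumes "puiseux_monoid M" "OHFM M"
  shows "finite (atoms M) \<and> card (atoms M) \<le> 2"
proof (rule ccontr)
  assume "\<not> ?thesis"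
  \<comment> \<open>An infinite set has \<open>card\<close> 0 and would satisfy the bound, hence the
    separate case.\<close>
  then consider "infinite (atoms M)" | "3 \<le> card (atoms M)" by linarith
  then have "\<exists>T \<subseteq> atoms M. card T = 3"
    by cases (metis infinite_arbitrarily_large, metis obtain_subset_with_card_n)
  then obtain x y z where "{x, y, z} \<subseteq> atoms M" "x \<noteq> y" "x \<noteq> z" "y \<noteq> z"
    by (auto simp: card_3_iff)
  then have "\<exists>a b c. {a, b, c} \<subseteq> atoms M \<and> a < b \<and> b < c"
    by (metis insert_commute linorder_neqE)
  then show False
    using three_atoms_imp_not_OHFM assms by blast
qed

lemma card_le_2_eq_pair:
  assumes "finite A" "card A \<le> 2" "A \<noteq> {}"
  obtains a b where "A = {a, b}"
proof -
  have "card A = 1 \<or> card A = 2" using assms by (auto simp: card_gt_0_iff le_Suc_eq numeral_2_eq_2)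
  then show thesis using that by (auto simp: card_1_singleton_iff card_2_iff)
qed

lemma two_atoms_imp_OHFM:
  fixes M :: "rat set"
  assumes "atomic M" "atoms M = {a, b}"
  shows "OHFM M"
  unfolding OHFM_def
proof (intro conjI ballI impI)
  fix x z z' assume fac: "z \<in> factorizations M x" "z' \<in> factorizations M x" and sz: "size z = size z'"
  obtain i j where z: "z = replicate_mset i a + replicate_mset j b"
    using fac(1) assms(2) by (auto simp: factorizations_def elim: mset_over_pair)
  obtain i' j' where z': "z' = replicate_mset i' a + replicate_mset j' b"
    using fac(2) assms(2) by (auto simp: factorizations_def elim: mset_over_pair)
  have len: "i + j = i' + j'" using sz z z' by simp
  have "of_nat i * a + of_nat j * b = of_nat i' * a + of_nat j' * b"
    using fac z z' by (simp add: factorizations_def)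
  \<comment> \<open>Taken in \<open>rat\<close>, the difference may be negative. Substituting it
    into the equation of sums leaves one product equal to 0.\<close>
  moreover have "of_nat j - of_nat j' = (of_nat i' - of_nat i :: rat)"
    using len by (simp add: algebra_simps flip: of_nat_add)
  ultimately have "(of_nat i - of_nat i') * (a - b) = 0"
    by algebra
  then consider "a = b" | "i = i'" by auto
  then show "z = z'"
  proof cases
    \<comment> \<open>With a single atom, the length alone determines the multiset.\<close>
    case 1
    then show ?thesis unfolding z z' 1 using len by (intro multiset_eqI) simp
  next
    case 2
    then show ?thesis using len z z' by simp
  qed
qed (fact assms(1))

lemma two_atoms_carrier:
  fixes M :: "rat set"
  assumes "add_submonoid M" "atomic M" "atoms M = {a, b}"
  shows "M = {of_nat i * a + of_nat j * b |i j. True}"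
proof (intro equalityI subsetI)
  fix x assume x: "x \<in> M"
  show "x \<in> {of_nat i * a + of_nat j * b |i j. True}"
  proof (cases "x = 0")
    case True
    then have "x = of_nat 0 * a + of_nat 0 * b" by simp
    then show ?thesis by blast
  next
    case False
    then obtain z where "z \<in> factorizations M x"
      using x assms(2) unfolding atomic_def by blast
    then have z: "set_mset z \<subseteq> {a, b}" "\<Sum>\<^sub># z = x"
      using assms(3) by (simp_all add: factorizations_def)
    from z(1) obtain i j where "z = replicate_mset i a + replicate_mset j b"
      by (rule mset_over_pair)
    with z(2) have "x = of_nat i * a + of_nat j * b" by simp
    then show ?thesis by blast
  qed
next
  fix x assume "x \<in> {of_nat i * a + of_nat j * b |i j. True}"
  then obtain i j where x: "x = \<Sum>\<^sub># (replicate_mset i a + replicate_mset j b)" by auto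
  have "{a, b} \<subseteq> M" unfolding assms(3)[symmetric] by (auto simp: atoms_def)
  then show "x \<in> M"
    unfolding x by (intro sum_mset_in_add_submonoid assms) (auto split: if_splits)
qed

lemma two_atoms_imp_numerical:
  fixes M :: "rat set"
  assumes M: "puiseux_monoid M" "atomic M" "atoms M = {a, b}"
  obtains N where "numerical_monoid N" "monoid_isomorphic M N"
proof -
  have sub: "add_submonoid M" using M(1) by (simp add: puiseux_monoid_def)
  have "{a, b} \<subseteq> M - {0}" unfolding M(3)[symmetric] by (auto simp: atoms_def)
  then have pos: "0 < a" "0 < b" using M(1) by (auto simp: puiseux_monoid_def order_less_le)
  then have "0 < a / b" by simp
  then obtain p q :: nat where pq: "0 < p" "0 < q" "coprime p q" "a / b = of_nat p / of_nat q"
    by (rule pos_rat_coprime_fraction)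
  \<comment> \<open>The common unit of the two atoms: \<open>a\<close> and \<open>b\<close> are
    \<open>p\<close> and \<open>q\<close> times \<open>t\<close>, so \<open>M\<close> is
    \<open>N\<close> scaled by \<open>t\<close>.\<close>
  define t where "t = b / of_nat q"
  have t: "0 < t" "a = of_nat p * t" "b = of_nat q * t"
    using pos pq by (auto simp: t_def field_simps)
  define N where "N = {i * p + j * q |i j. True}"
  define g where "g = (\<lambda>n. of_nat n * t)"
  \<comment> \<open>Division by \<open>t\<close>. On \<open>M\<close> the quotient is already a
    natural number, so \<open>nat\<close> and the floor only change the type.\<close>
  define f where "f = (\<lambda>x. nat \<lfloor>x / t\<rfloor>)"
  have fg: "f (g n) = n" for n using t(1) by (simp add: f_def g_def)
  have g_add: "g (m + n) = g m + g n" for m n by (simp add: g_def algebra_simps)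
  have g_comb: "g (i * p + j * q) = of_nat i * a + of_nat j * b" for i j
    by (simp add: g_def t algebra_simps)
  have gN: "M = g ` N"
    unfolding two_atoms_carrier[OF sub M(2,3)] N_def g_comb[symmetric] by auto
  show thesis
  proof (rule that)
    show "numerical_monoid N" unfolding N_def using pq by (intro numerical_monoid_coprime)
    have "bij_betw f M N" by (rule bij_betw_byWitness[where f' = g]) (auto simp: gN fg)
    moreover have "f 0 = 0" by (simp add: f_def)
    moreover have "f (x + y) = f x + f y" if "x \<in> M" "y \<in> M" for x y
      using that by (auto simp: gN fg simp flip: g_add)
    ultimately show "monoid_isomorphic M N" by (auto simp: monoid_isomorphic_def)
  qed
qed

theorem proposition4p25:
  fixes M :: "rat set"
  assumes "puiseux_monoid M" and "M \<noteq> {0}" and "atomic M"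
  shows "(OHFM M \<longleftrightarrow> finite (atoms M) \<and> card (atoms M) \<le> 2) \<and>
         (finite (atoms M) \<and> card (atoms M) \<le> 2 \<longleftrightarrow>
            (\<exists>N. numerical_monoid N \<and> embedding_dimension N \<in> {1, 2} \<and>
                 monoid_isomorphic M N))"
proof -
  have sub: "add_submonoid M" using assms(1) by (simp add: puiseux_monoid_def)
  then obtain x where x: "x \<in> M - {0}" using assms(2) by (auto simp: add_submonoid_def)
  then obtain z where "z \<in> factorizations M x" using assms(3) by (auto simp: atomic_def)
  \<comment> \<open>The empty multiset has sum 0, so a factorization of the nonzero \<open>x\<close>
    contains an atom.\<close>
  then have ne: "atoms M \<noteq> {}" using x by (auto simp: factorizations_def)
  have "OHFM M \<and> (\<exists>N. numerical_monoid N \<and> embedding_dimension N \<in> {1, 2} \<and> monoid_isomorphic M N)"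
    if at: "finite (atoms M)" "card (atoms M) \<le> 2"
  proof
    obtain a b where ab: "atoms M = {a, b}"
      using at ne by (rule card_le_2_eq_pair)
    show "OHFM M" using assms(3) ab by (rule two_atoms_imp_OHFM)
    obtain N where N: "numerical_monoid N" "monoid_isomorphic M N"
      using assms(1,3) ab by (rule two_atoms_imp_numerical)
    have "card (atoms M) \<in> {1, 2}" unfolding ab by (cases "a = b") auto
    then have "embedding_dimension N \<in> {1, 2}"
      using card_atoms_isomorphic[OF sub N(2)] by (simp add: embedding_dimension_def)
    with N show "\<exists>N. numerical_monoid N \<and> embedding_dimension N \<in> {1, 2} \<and> monoid_isomorphic M N"
      by blast
  qed
  moreover have "finite (atoms M) \<and> card (atoms M) \<le> 2"
    if "embedding_dimension N \<in> {1, 2}" "monoid_isomorphic M N" for N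
  proof -
    have "card (atoms M) \<in> {1, 2}"
      using that(1) card_atoms_isomorphic[OF sub that(2)] by (simp add: embedding_dimension_def)
    \<comment> \<open>A positive \<open>card\<close> rules out the default value 0 of infinite sets,
      which gives finiteness.\<close>
    then show ?thesis by (auto intro: card_ge_0_finite)
  qed
  ultimately show ?thesis using OHFM_imp_at_most_two_atoms[OF assms(1)] by blast
qed

end
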